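(* Let $q \geq 1$ and let $\mathbf{A} = (A_1,\ldots,A_q)$ be a normalized $q$-tuple of finite sets of integers. Let $a_i^* = \max(A_i) \geq 1$ for all $i \in [1,q]$ and $\mathbf{a}^* = (a_1^*,\ldots,a_q^* )$. For every positive integer $t$ there exist nonnegative integers $c_t$ and $d_t$, finite sets of nonnegative integers $C_t$ and $D_t$, and a vector $\mathbf{h}_t = (h_{t,1},\ldots,h_{t,q}) \in \mathbf{N}_0^q$ such that, for every $\mathbf{h} = (h_1,\ldots,h_q) \in \mathbf{N}_0^q$ with $\mathbf{h} \succeq \mathbf{h}_t$, \[ (\mathbf{h}\cdot\mathbf{A})^{(t)} = C_t \cup [c_t, \mathbf{h}\cdot\mathbf{a}^* - d_t] \cup (\mathbf{h}\cdot\mathbf{a}^* - D_t). \]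
   Context: $\mathbf{N}_0^q$ is the set of $q$-tuples of nonnegative integers. For integers $u \le v$, $[u,v] = \{n\in\mathbf{Z}: u\le n\le v\}$ (empty if $u>v$). For a set $D$ and integer $v$, $v - D = \{v-d : d\in D\}$. A $q$-tuple $\mathbf{A} = (A_1,\ldots,A_q)$ of finite sets of integers is normalized if $\min(A_i)=0$ for all $i$ and $\gcd\left(\bigcup_{i=1}^q A_i\right) = 1$ (the sets $A_i$ need not be disjoint). For $\mathbf{h}=(h_1,\ldots,h_q)\in\mathbf{N}_0^q$, $\mathbf{h}\cdot\mathbf{A} = h_1A_1+\cdots+h_qA_q$, where $h_iA_i$ is the set of sums of $h_i$ not necessarily distinct elements of $A_i$ (with $0A_i=\{0\}$), and $\mathbf{h}\cdot\mathbf{a}^* = \sum_{i=1}^q h_i a_i^*$. The representation function $r_{\mathbf{A},\mathbf{h}}(n)$ is the number of $q$-tuples $(\mathbf{a}_1,\ldots,\mathbf{a}_q)$ with $\mathbf{a}_i = (a_{i,1},\ldots,a_{i,h_i}) \in A_i^{h_i}$, $a_{i,1}\le\cdots\le a_{i,h_i}$, and $n = \sum_{i=1}^q\sum_{j=1}^{h_i} a_{i,j}$. For a positive integer $t$, $(\mathbf{h}\cdot\mathbf{A})^{(t)} = \{n\in\mathbf{h}\cdot\mathbf{A} : r_{\mathbf{A},\mathbf{h}}(n)\ge t\}$. The partial order on $\mathbf{N}_0^q$: $(h_1,\ldots,h_q) \preceq (h'_1,\ldots,h'_q)$ iff $h_i \le h'_i$ for all $i$; $\mathbf{h}'\succeq\mathbf{h}$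 means $\mathbf{h}\preceq\mathbf{h}'$.
   Formalization: The case q = 1, A_1 = {0,1}, t ≥ 2 is excluded, because there every integer has at most one representation, so the left-hand set is always empty while the interval [c_t, h·a* − d_t] is nonempty for large h. *)

theory Defs
  imports Main "HOL-Library.FuncSet" "HOL-Library.Set_Algebras"
begin

text \<open>
  A \<open>q\<close>-tuple is a function on \<open>nat\<close> of which only the values on the index set \<open>{1..q}\<close> are used.
\<close>

definition normalized_tuple :: "nat \<Rightarrow> (nat \<Rightarrow> int set) \<Rightarrow> bool" where
  "normalized_tuple q A \<longleftrightarrow>
     (\<forall>i\<in>{1..q}. finite (A i) \<and> A i \<noteq> {} \<and> Min (A i) = 0) \<and> Gcd (\<Union>i\<in>{1..q}. A i) = 1"

definition nfold_sumset :: "nat \<Rightarrow> int set \<Rightarrow> int set" where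
  "nfold_sumset h A = {sum_list xs | xs. length xs = h \<and> set xs \<subseteq> A}"

text \<open>The sum below is the Minkowski sum of sets, with neutral element \<open>{0}\<close>.\<close>

definition tuple_sumset :: "nat \<Rightarrow> (nat \<Rightarrow> nat) \<Rightarrow> (nat \<Rightarrow> int set) \<Rightarrow> int set" where
  "tuple_sumset q h A = (\<Sum>i=1..q. nfold_sumset (h i) (A i))"

text \<open>
  The extensional function space makes the functions counted correspond exactly to the \<open>q\<close>-tuples.
\<close>

definition rep_count :: "nat \<Rightarrow> (nat \<Rightarrow> int set) \<Rightarrow> (nat \<Rightarrow> nat) \<Rightarrow> int \<Rightarrow> nat" where
  "rep_count q A h n =
     card {a \<in> (\<Pi>\<^sub>E i\<in>{1..q}. {xs :: int list. length xs = h i \<and> set xs \<subseteq> A i \<and> sorted xs}).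
             n = (\<Sum>i=1..q. sum_list (a i))}"

definition tuple_sumset_rep :: "nat \<Rightarrow> (nat \<Rightarrow> nat) \<Rightarrow> (nat \<Rightarrow> int set) \<Rightarrow> nat \<Rightarrow> int set" where
  "tuple_sumset_rep q h A t = {n \<in> tuple_sumset q h A. rep_count q A h n \<ge> t}"

definition tuple_le :: "nat \<Rightarrow> (nat \<Rightarrow> nat) \<Rightarrow> (nat \<Rightarrow> nat) \<Rightarrow> bool" where
  "tuple_le q h h' \<longleftrightarrow> (\<forall>i\<in>{1..q}. h i \<le> h' i)"

definition tuple_dot :: "nat \<Rightarrow> (nat \<Rightarrow> nat) \<Rightarrow> (nat \<Rightarrow> int) \<Rightarrow> int" where
  "tuple_dot q h a = (\<Sum>i=1..q. int (h i) * a i)"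

text \<open>
  The case \<open>q = 1\<close>, \<open>A 1 = {0, 1}\<close>, \<open>t \<ge> 2\<close> has to be excluded from the structure theorem:
  every integer then has at most one representation, so the set of integers with at least \<open>t\<close>
  representations is empty, while the interval in the theorem is nonempty for large \<open>h\<close>.
\<close>

lemma sorted_01_unique:
  fixes xs ys :: "int list"
  assumes "length xs = length ys" "set xs \<subseteq> {0, 1}" "set ys \<subseteq> {0, 1}" "sorted xs" "sorted ys"
    "sum_list xs = sum_list ys"
  shows "xs = ys"
  using assms
proof (induction xs ys rule: list_induct2)
  case (Cons x xs y ys)
  have ones: "sum_list zs = int (length zs)" if "set zs \<subseteq> {1}" for zs :: "int list"
    using that by (induction zs) auto
  have le: "sum_list zs \<le> int (length zs)" if "set zs \<subseteq> {0, 1}" for zs :: "int list"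
    using that by (induction zs) auto
  have "x = y"
  proof (rule ccontr)
    assume "x \<noteq> y"
    then consider "x = 0" "y = 1" | "x = 1" "y = 0"
      using Cons.prems by auto
    then show False
    proof cases
      case 1
      then have "set ys \<subseteq> {1}" using Cons.prems by force
      then show False using ones[of ys] le[of xs] 1 Cons.hyps Cons.prems by simp
    next
      case 2
      then have "set xs \<subseteq> {1}" using Cons.prems by force
      then show False using ones[of xs] le[of ys] 2 Cons.hyps Cons.prems by simp
    qed
  qed
  then show ?case using Cons by auto
qed simp

lemma exceptional_case:
  fixes A :: "nat \<Rightarrow> int set" and t :: nat
  assumes A: "A 1 = {0, 1}" and t: "t \<ge> 2"
  shows "\<not> (\<exists>(c::int) (d::int) (C::int set) (D::int set) (ht::nat \<Rightarrow> nat).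
    \<forall>h. tuple_le 1 ht h \<longrightarrow>
      tuple_sumset_rep 1 h A t =
        C \<union> {c .. tuple_dot 1 h (\<lambda>i. Max (A i)) - d}
          \<union> (\<lambda>x. tuple_dot 1 h (\<lambda>i. Max (A i)) - x) ` D)"
proof
  have empty: "tuple_sumset_rep 1 h A t = {}" for h
  proof -
    have le1: "rep_count 1 A h n \<le> Suc 0" for n
      unfolding rep_count_def
    proof (rule card_le_Suc0_iff_eq[THEN iffD2], goal_cases)
      case 1
      have "finite {xs :: int list. length xs = h i \<and> set xs \<subseteq> A i \<and> sorted xs}"
        if "i \<in> {1..1}" for i
        by (rule finite_subset[OF _ finite_lists_length_eq[of "A 1" "h i"]]) (use that A in auto)
      then have "finite (\<Pi>\<^sub>E i\<in>{1..1}. {xs :: int list. length xs = h i \<and> set xs \<subseteq> A i \<and> sorted xs})"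
        by (intro finite_PiE) auto
      then show ?case by simp
    next
      case 2
      show ?case
      proof (intro ballI)
        fix a b
        assume a: "a \<in> {a \<in> (\<Pi>\<^sub>E i\<in>{1..1}. {xs. length xs = h i \<and> set xs \<subseteq> A i \<and> sorted xs}).
                     n = (\<Sum>i=1..1. sum_list (a i))}"
          and b: "b \<in> {a \<in> (\<Pi>\<^sub>E i\<in>{1..1}. {xs. length xs = h i \<and> set xs \<subseteq> A i \<and> sorted xs}).
                     n = (\<Sum>i=1..1. sum_list (a i))}"
        let ?T = "\<lambda>i. {xs :: int list. length xs = h i \<and> set xs \<subseteq> A i \<and> sorted xs}"
        have a': "a \<in> (\<Pi>\<^sub>E i\<in>{1..1}. ?T i)" and b': "b \<in> (\<Pi>\<^sub>E i\<in>{1..1}. ?T i)"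
          using a b by blast+
        have "a 1 \<in> ?T 1" "b 1 \<in> ?T 1"
          using PiE_mem[OF a', of 1] PiE_mem[OF b', of 1] by simp_all
        moreover have "sum_list (a 1) = sum_list (b 1)" using a b by simp
        ultimately have "a 1 = b 1" using A sorted_01_unique[of "a 1" "b 1"] by simp
        then show "a = b" using PiE_ext[OF a' b'] by simp
      qed
    qed
    have "\<not> t \<le> rep_count 1 A h n" for n
      using t le1[of n] by linarith
    then show ?thesis by (simp add: tuple_sumset_rep_def)
  qed
  assume "\<exists>(c::int) (d::int) (C::int set) (D::int set) (ht::nat \<Rightarrow> nat).
    \<forall>h. tuple_le 1 ht h \<longrightarrow>
      tuple_sumset_rep 1 h A t =
        C \<union> {c .. tuple_dot 1 h (\<lambda>i. Max (A i)) - d}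
          \<union> (\<lambda>x. tuple_dot 1 h (\<lambda>i. Max (A i)) - x) ` D"
  then obtain c d :: int and C D :: "int set" and ht :: "nat \<Rightarrow> nat" where *:
    "\<And>h. tuple_le 1 ht h \<Longrightarrow> tuple_sumset_rep 1 h A t =
        C \<union> {c .. tuple_dot 1 h (\<lambda>i. Max (A i)) - d}
          \<union> (\<lambda>x. tuple_dot 1 h (\<lambda>i. Max (A i)) - x) ` D" by metis
  define h where "h = (\<lambda>i::nat. max (ht i) (nat (c + d)))"
  have "tuple_le 1 ht h" by (simp add: tuple_le_def h_def)
  moreover have "tuple_dot 1 h (\<lambda>i. Max (A i)) = int (h 1)"
    using A by (simp add: tuple_dot_def)
  moreover have "c \<le> int (h 1) - d" by (simp add: h_def)
  ultimately have "c \<in> tuple_sumset_rep 1 h A t" by (subst *) simp_all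
  then show False by (simp only: empty empty_iff)
qed

end

theory Submission
  imports Defs "HOL-Library.Multiset"
begin

text \<open>
  Adding a fixed representation of \<open>m\<close> by a vector \<open>k\<close> injects the representations of \<open>n\<close> by \<open>h\<close>
  into those of \<open>n + m\<close> by \<open>h + k\<close>.  Since the gcd is 1, two consecutive integers \<open>x\<close>, \<open>x + 1\<close>
  are representable, hence so are all of \<open>W x, \<dots>, W x + W\<close>.  Shifting by an integer that has \<open>t\<close>
  representations (exchange \<open>b\<close> copies of \<open>a\<close> for \<open>a\<close> copies of \<open>b\<close>) gives, for some \<open>h\<close>, an interval of
  length \<open>W\<close> all of whose elements have \<open>t\<close> representations.  If \<open>W\<close> is at least every \<open>a_max i\<close>,
  raising \<open>h i\<close> by one lengthens this interval by \<open>a_max i\<close>, so that its distance to both ends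
  of \<open>[0, h \<cdot> a_max]\<close> stays bounded.  Near 0 the set stabilises by monotonicity in \<open>h\<close>, and near the
  other end by the reflection \<open>A i \<mapsto> a_max i - A i\<close>.
\<close>

section \<open>Representations as tuples of multisets\<close>

text \<open>Multisets replace the sorted lists of \<open>rep_count\<close>: adding two
  representations is then plain \<open>+\<close>, with no merging, and cancellation gives
  injectivity.\<close>

definition reps :: "nat \<Rightarrow> (nat \<Rightarrow> int set) \<Rightarrow> (nat \<Rightarrow> nat) \<Rightarrow> int \<Rightarrow> (nat \<Rightarrow> int multiset) set" where
  "reps q A h n =
     {M \<in> (\<Pi>\<^sub>E i\<in>{1..q}. {X. size X = h i \<and> set_mset X \<subseteq> A i}). n = (\<Sum>i=1..q. sum_mset (M i))}"

lemma repsI: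
  assumes "\<And>i. i \<in> {1..q} \<Longrightarrow> size (M i) = h i" "\<And>i. i \<in> {1..q} \<Longrightarrow> set_mset (M i) \<subseteq> A i"
    and "n = (\<Sum>i=1..q. sum_mset (M i))"
  shows "restrict M {1..q} \<in> reps q A h n"
  using assms unfolding reps_def by auto

lemma repsD:
  assumes "M \<in> reps q A h n"
  shows "\<And>i. i \<in> {1..q} \<Longrightarrow> size (M i) = h i" "\<And>i. i \<in> {1..q} \<Longrightarrow> set_mset (M i) \<subseteq> A i"
    and "n = (\<Sum>i=1..q. sum_mset (M i))" "M \<in> extensional {1..q}"
  using assms unfolding reps_def PiE_iff by blast+

lemma reps_cong:
  assumes "\<And>i. i \<in> {1..q} \<Longrightarrow> h i = h' i"
  shows "reps q A h n = reps q A h' n"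
proof -
  have "(\<Pi>\<^sub>E i\<in>{1..q}. {X. size X = h i \<and> set_mset X \<subseteq> A i})
      = (\<Pi>\<^sub>E i\<in>{1..q}. {X. size X = h' i \<and> set_mset X \<subseteq> A i})"
    using assms by (intro PiE_cong) simp
  then show ?thesis unfolding reps_def by simp
qed

text \<open>Each multiset has exactly one sorted enumeration, so \<open>mset\<close> and
  \<open>sorted_list_of_multiset\<close> are mutually inverse in every component.\<close>

lemma rep_count_eq_card_reps: "rep_count q A h n = card (reps q A h n)"
  unfolding rep_count_def
proof (rule bij_betw_same_card)
  let ?L = "{a \<in> (\<Pi>\<^sub>E i\<in>{1..q}. {xs :: int list. length xs = h i \<and> set xs \<subseteq> A i \<and> sorted xs}).
             n = (\<Sum>i=1..q. sum_list (a i))}"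
  let ?f = "\<lambda>a. restrict (\<lambda>i. mset (a i)) {1..q}"
  let ?g = "\<lambda>M. restrict (\<lambda>i. sorted_list_of_multiset (M i)) {1..q}"
  show "bij_betw ?f ?L (reps q A h n)"
  proof (rule bij_betw_byWitness[where f' = ?g])
    show "\<forall>a\<in>?L. ?g (?f a) = a"
      by (auto simp: PiE_iff sorted_sort_id intro!: extensionalityI[of _ "{1..q}"])
    show "\<forall>M\<in>reps q A h n. ?f (?g M) = M"
      by (auto dest: repsD(4) intro!: extensionalityI[of _ "{1..q}"])
    show "?f ` ?L \<subseteq> reps q A h n"
      by (auto intro!: repsI simp: PiE_iff sum_mset_sum_list subset_eq simp del: One_nat_def)
    have "length (sorted_list_of_multiset X) = size X" "sum_list (sorted_list_of_multiset X) = sum_mset X"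
      for X :: "int multiset"
      by (metis mset_sorted_list_of_multiset size_mset) (metis mset_sorted_list_of_multiset sum_mset_sum_list)
    then show "?g ` reps q A h n \<subseteq> ?L"
      by (auto simp: reps_def PiE_iff subset_eq simp del: One_nat_def)
  qed
qed

lemma reps_imp_mem_tuple_sumset:
  assumes "M \<in> reps q A h n"
  shows "n \<in> tuple_sumset q h A"
proof -
  have "sum_mset (M i) \<in> nfold_sumset (h i) (A i)" if "i \<in> {1..q}" for i
  proof -
    obtain xs where "mset xs = M i" using ex_mset by blast
    with repsD(1,2)[OF assms that] show ?thesis
      unfolding nfold_sumset_def
      by (intro CollectI exI[of _ xs]) (metis set_mset_mset size_mset sum_mset_sum_list)
  qed
  then show ?thesis
    using repsD(3)[OF assms] unfolding tuple_sumset_def by (auto simp: set_sum_alt)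
qed

text \<open>For \<open>t \<ge> 1\<close> a count of at least \<open>t\<close> already provides a
  representation, which places \<open>n\<close> in the sumset.\<close>

lemma tuple_sumset_rep_eq:
  assumes "t \<ge> 1"
  shows "tuple_sumset_rep q h A t = {n. t \<le> card (reps q A h n)}"
proof -
  have "n \<in> tuple_sumset q h A" if "t \<le> card (reps q A h n)" for n
  proof -
    have "reps q A h n \<noteq> {}" using that assms by auto
    then show ?thesis using reps_imp_mem_tuple_sumset by blast
  qed
  then show ?thesis by (auto simp: tuple_sumset_rep_def rep_count_eq_card_reps)
qed

text \<open>Closure under differences makes \<open>G\<close> a subgroup, hence closed under integer
  multiples; Bezout then handles the elements of \<open>U\<close> one at a time.\<close>

lemma Gcd_mem_of_subgroup:
  fixes U G :: "int set"
  assumes "finite U" "U \<subseteq> G" "0 \<in> G" and diff: "\<And>x y. x \<in> G \<Longrightarrow> y \<in> G \<Longrightarrow> x - y \<in> G"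
  shows "Gcd U \<in> G"
proof -
  have uminus: "- x \<in> G" if "x \<in> G" for x using diff[OF \<open>0 \<in> G\<close> that] by simp
  have add: "x + y \<in> G" if "x \<in> G" "y \<in> G" for x y using diff[OF that(1) uminus[OF that(2)]] by simp
  have nmult: "int k * x \<in> G" if "x \<in> G" for k x
    by (induction k) (auto simp: algebra_simps \<open>0 \<in> G\<close> that add)
  have mult: "k * x \<in> G" if "x \<in> G" for k x
    using nmult[OF that, of "nat \<bar>k\<bar>"] uminus[of "\<bar>k\<bar> * x"] by (cases "k \<ge> 0") auto
  show ?thesis
    using assms(1,2)
  proof induction
    case (insert x U)
    obtain u v where "u * x + v * Gcd U = gcd x (Gcd U)" using bezout_int by blast
    with insert show ?case by (metis Gcd_insert add mult insert_subset)
  qed (use assms in simp)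
qed

section \<open>Finite families: shifting representations\<close>

text \<open>These properties are shared by \<open>A\<close> and its reflection, so that the results
  below serve both ends of the range.\<close>

locale finite_family =
  fixes q :: nat and A :: "nat \<Rightarrow> int set"
  assumes finite_A: "i \<in> {1..q} \<Longrightarrow> finite (A i)"
    and zero_in_A: "i \<in> {1..q} \<Longrightarrow> 0 \<in> A i"
    and nonneg_A: "i \<in> {1..q} \<Longrightarrow> a \<in> A i \<Longrightarrow> 0 \<le> a"
begin

lemma finite_reps: "finite (reps q A h n)"
proof -
  have "finite {X. size X = h i \<and> set_mset X \<subseteq> A i}" if "i \<in> {1..q}" for i
  proof (rule finite_subset)
    show "{X. size X = h i \<and> set_mset X \<subseteq> A i} \<subseteq> mset ` {xs. set xs \<subseteq> A i \<and> length xs = h i}"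
    proof
      fix X assume X: "X \<in> {X. size X = h i \<and> set_mset X \<subseteq> A i}"
      obtain xs where "mset xs = X" using ex_mset by blast
      with X show "X \<in> mset ` {xs. set xs \<subseteq> A i \<and> length xs = h i}" by force
    qed
  qed (use finite_lists_length_eq[OF finite_A[OF that]] in simp)
  then have "finite (\<Pi>\<^sub>E i\<in>{1..q}. {X. size X = h i \<and> set_mset X \<subseteq> A i})"
    by (intro finite_PiE) auto
  then show ?thesis unfolding reps_def by simp
qed

lemma reps_nonneg:
  assumes "M \<in> reps q A h n"
  shows "0 \<le> n"
proof -
  have "0 \<le> sum_mset X" if "set_mset X \<subseteq> {0..}" for X :: "int multiset"
    using that by (induction X) auto
  moreover have "set_mset (M i) \<subseteq> {0..}" if "i \<in> {1..q}" for i
    using repsD(2)[OF assms that] nonneg_A[OF that] by auto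
  ultimately show ?thesis
    unfolding repsD(3)[OF assms] by (intro sum_nonneg) blast
qed

text \<open>Multiset addition is cancellative, so \<open>M\<close> can be recovered from its sum
  with the fixed \<open>K\<close>.\<close>

lemma card_reps_shift:
  assumes "K \<in> reps q A k m"
  shows "card (reps q A h n) \<le> card (reps q A (\<lambda>i. h i + k i) (n + m))"
proof (rule card_inj_on_le)
  let ?f = "\<lambda>M. restrict (\<lambda>i. M i + K i) {1..q}"
  show "inj_on ?f (reps q A h n)"
  proof (rule inj_onI)
    fix M M' assume M: "M \<in> reps q A h n" "M' \<in> reps q A h n" and eq: "?f M = ?f M'"
    have "M i = M' i" if "i \<in> {1..q}" for i
      using fun_cong[OF eq, of i] that by simp
    then show "M = M'" using M repsD(4) by (intro extensionalityI[of _ "{1..q}"]) blast+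
  qed
  show "?f ` reps q A h n \<subseteq> reps q A (\<lambda>i. h i + k i) (n + m)"
  proof clarify
    fix M assume M: "M \<in> reps q A h n"
    show "?f M \<in> reps q A (\<lambda>i. h i + k i) (n + m)"
      using repsD(1,2)[OF M] repsD(1,2)[OF assms] repsD(3)[OF M] repsD(3)[OF assms]
      by (intro repsI) (simp_all add: sum.distrib)
  qed
  show "finite (reps q A (\<lambda>i. h i + k i) (n + m))" by (rule finite_reps)
qed

lemma zero_rep: "restrict (\<lambda>i. replicate_mset (k i) 0) {1..q} \<in> reps q A k 0"
  using zero_in_A by (intro repsI) (auto split: if_splits)

lemma singleton_rep:
  assumes "i \<in> {1..q}" "a \<in> A i"
  shows "restrict (\<lambda>j. if j = i then {#a#} else {#}) {1..q} \<in> reps q A (\<lambda>j. if j = i then 1 else 0) a"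
  using assms by (intro repsI) (auto simp: if_distrib[of sum_mset] cong: if_cong)

text \<open>Since \<open>0 \<in> A i\<close>, padding with \<open>h' i - h i\<close> zeros leaves
  the sum unchanged; this is the shift by \<open>zero_rep\<close>.\<close>

lemma card_reps_mono:
  assumes "tuple_le q h h'"
  shows "card (reps q A h n) \<le> card (reps q A h' n)"
proof -
  have "card (reps q A h n) \<le> card (reps q A (\<lambda>i. h i + (h' i - h i)) (n + 0))"
    by (rule card_reps_shift[OF zero_rep])
  also have "reps q A (\<lambda>i. h i + (h' i - h i)) (n + 0) = reps q A h' n"
    using assms by (subst reps_cong[of q _ h']) (auto simp: tuple_le_def)
  finally show ?thesis .
qed

section \<open>Integers with at least one representation\<close>

text \<open>As \<open>h\<close> is free, this is the additive monoid generated by all the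
  \<open>A i\<close>.\<close>

definition representable :: "int set" where
  "representable = {n. \<exists>h. reps q A h n \<noteq> {}}"

lemma zero_in_representable: "0 \<in> representable"
  using zero_rep unfolding representable_def by blast

lemma mem_representable: "i \<in> {1..q} \<Longrightarrow> a \<in> A i \<Longrightarrow> a \<in> representable"
  using singleton_rep unfolding representable_def by blast

lemma nonneg_representable: "x \<in> representable \<Longrightarrow> 0 \<le> x"
  using reps_nonneg unfolding representable_def by blast

lemma add_representable:
  assumes "x \<in> representable" "y \<in> representable"
  shows "x + y \<in> representable"
proof -
  obtain h k M K where M: "M \<in> reps q A h x" "K \<in> reps q A k y"
    using assms unfolding representable_def by blast
  then have "0 < card (reps q A h x)" using finite_reps card_gt_0_iff by blast
  then have "0 < card (reps q A (\<lambda>i. h i + k i) (x + y))"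
    using card_reps_shift[OF M(2), of h x] by linarith
  then show ?thesis unfolding representable_def using card_gt_0_iff by blast
qed

lemma mult_representable: "x \<in> representable \<Longrightarrow> int k * x \<in> representable"
  by (induction k) (auto simp: algebra_simps zero_in_representable add_representable)

lemma representable_window:
  assumes "Gcd (\<Union>i\<in>{1..q}. A i) = 1"
  shows "\<exists>N\<ge>0. {N..N + int W} \<subseteq> representable"
proof -
  \<comment> \<open>\<open>G\<close> is the group generated by the monoid. That it contains the gcd
    1 means that two consecutive integers are representable.\<close>
  define G where "G = {x - y |x y. x \<in> representable \<and> y \<in> representable}"
  have GI: "x - y \<in> G" if "x \<in> representable" "y \<in> representable" for x y
    using that unfolding G_def by blast
  have "Gcd (\<Union>i\<in>{1..q}. A i) \<in> G"
  proof (rule Gcd_mem_of_subgroup)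
    show "(\<Union>i\<in>{1..q}. A i) \<subseteq> G"
      using GI[OF mem_representable zero_in_representable] by fastforce
    show "0 \<in> G" using GI[OF zero_in_representable zero_in_representable] by simp
    show "u - v \<in> G" if "u \<in> G" "v \<in> G" for u v
    proof -
      obtain x y x' y' where "u = x - y" "v = x' - y'"
        and s: "x \<in> representable" "y \<in> representable" "x' \<in> representable" "y' \<in> representable"
        using \<open>u \<in> G\<close> \<open>v \<in> G\<close> unfolding G_def by blast
      then have "u - v = (x + y') - (y + x')" by simp
      then show ?thesis using GI[OF add_representable add_representable] s by metis
    qed
  qed (use finite_A in auto)
  then obtain x y where xy: "x \<in> representable" "y \<in> representable" "x = y + 1"
    using assms unfolding G_def by (auto simp: eq_diff_eq add.commute)
  \<comment> \<open>Of \<open>W\<close> summands, \<open>j\<close> are \<open>x = y + 1\<close> and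
    the others are \<open>y\<close>.\<close>
  have "int W * y + int j \<in> representable" if "j \<le> W" for j
  proof -
    have "int j * x + int (W - j) * y \<in> representable"
      by (intro add_representable mult_representable xy)
    then show ?thesis using that xy(3) by (simp add: of_nat_diff algebra_simps)
  qed
  then have "{int W * y..int W * y + int W} \<subseteq> representable"
    by (auto dest!: zle_iff_zadd[THEN iffD1])
  then show ?thesis using nonneg_representable[OF xy(2)] by (intro exI[of _ "int W * y"]) simp
qed

section \<open>An integer with many representations\<close>

text \<open>For each \<open>s \<le> t\<close>, \<open>s * b\<close> copies of \<open>a\<close> and
  \<open>(t - s) * a\<close> copies of \<open>b\<close> sum to \<open>t * a * b\<close>. This gives
  \<open>t + 1\<close> representations.\<close>

lemma reps_of_two_coins:
  assumes "i \<in> {1..q}" "j \<in> {1..q}" "a \<in> A i" "b \<in> A j" "0 < a" "0 < b" "(i, a) \<noteq> (j, b)"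
  shows "\<exists>h m. t \<le> card (reps q A h m)"
proof -
  define u v where "u = nat a" and "v = nat b"
  have uv: "a = int u" "b = int v" "0 < u" "0 < v" using assms by (auto simp: u_def v_def)
  \<comment> \<open>The zeros bring the sizes to \<open>t * v\<close> for \<open>P\<close> and
    \<open>t * u\<close> for \<open>Q\<close>, independently of \<open>s\<close>; the definition of
    \<open>h\<close> adds the two when \<open>i = j\<close>.\<close>
  define P where "P s k = (if k = i then replicate_mset (s * v) a + replicate_mset ((t - s) * v) 0 else {#})"
    for s k
  define Q where "Q s k = (if k = j then replicate_mset ((t - s) * u) b + replicate_mset (s * u) 0 else {#})"
    for s k
  define h where "h k = (if k = i then t * v else 0) + (if k = j then t * u else 0)" for k
  let ?F = "\<lambda>s. restrict (\<lambda>k. P s k + Q s k) {1..q}"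
  have "card {..t} \<le> card (reps q A h (int t * a * b))"
  proof (rule card_inj_on_le)
    show "inj_on ?F {..t}"
    proof (rule inj_onI)
      fix s s' assume "?F s = ?F s'"
      then have "?F s i = ?F s' i" by (rule fun_cong)
      \<comment> \<open>This multiplicity is \<open>s * v\<close>: either
        \<open>i \<noteq> j\<close> and \<open>Q s i\<close> is empty, or \<open>a\<close> differs
        from both \<open>b\<close> and 0. As \<open>v > 0\<close>, it determines
        \<open>s\<close>.\<close>
      then have "count (P s i + Q s i) a = count (P s' i + Q s' i) a"
        using assms(1) by simp
      then show "s = s'" using assms uv by (auto simp: P_def Q_def split: if_splits)
    qed
    show "?F ` {..t} \<subseteq> reps q A h (int t * a * b)"
    proof clarify
      fix s assume "s \<le> t"
      have "(\<Sum>k=1..q. sum_mset (P s k + Q s k)) = int (s * v) * a + int ((t - s) * u) * b"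
        using assms(1,2)
        by (simp add: P_def Q_def sum.distrib if_distrib[of sum_mset] sum_mset_replicate_mset cong: if_cong)
      also have "\<dots> = int t * a * b"
        using \<open>s \<le> t\<close> by (simp add: uv of_nat_diff algebra_simps)
      finally show "?F s \<in> reps q A h (int t * a * b)"
        using assms zero_in_A \<open>s \<le> t\<close>
        by (intro repsI)
           (auto simp: P_def Q_def h_def add_mult_distrib[symmetric] split: if_splits)
    qed
    show "finite (reps q A h (int t * a * b))" by (rule finite_reps)
  qed
  then have "t \<le> card (reps q A h (int t * a * b))" by simp
  then show ?thesis by blast
qed

section \<open>Uniform vectors and growing intervals\<close>

text \<open>The componentwise sum of the finitely many witnesses dominates each of them, and counts
  are monotone in \<open>h\<close>.\<close>

lemma uniform_bound:
  assumes "finite I" "\<And>n. n \<in> I \<Longrightarrow> \<exists>h. t \<le> card (reps q A h n)"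
  shows "\<exists>h. \<forall>h'. tuple_le q h h' \<longrightarrow> (\<forall>n\<in>I. t \<le> card (reps q A h' n))"
proof -
  obtain H where H: "\<And>n. n \<in> I \<Longrightarrow> t \<le> card (reps q A (H n) n)" using assms(2) by metis
  define h where "h i = (\<Sum>n\<in>I. H n i)" for i
  have "tuple_le q (H n) h" if "n \<in> I" for n
    using assms(1) that by (auto simp: tuple_le_def h_def intro: member_le_sum)
  then have "tuple_le q (H n) h'" if "n \<in> I" "tuple_le q h h'" for n h'
    using that unfolding tuple_le_def by (meson order_trans)
  then show ?thesis using H card_reps_mono order_trans by (intro exI[of _ h]) blast
qed

text \<open>Adding any representation of \<open>n - m\<close> to the \<open>t\<close>
  representations of \<open>m\<close> gives \<open>t\<close> for \<open>n\<close>;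
  \<open>uniform_bound\<close> then merges the vectors depending on \<open>n\<close>.\<close>

lemma rep_window:
  assumes "Gcd (\<Union>i\<in>{1..q}. A i) = 1" "1 \<le> t" "t \<le> card (reps q A k m)"
  shows "\<exists>c\<ge>0. \<exists>h. \<forall>n\<in>{c..c + int W}. t \<le> card (reps q A h n)"
proof -
  obtain N where N: "0 \<le> N" "{N..N + int W} \<subseteq> representable"
    using representable_window[OF assms(1)] by blast
  have "reps q A k m \<noteq> {}" using assms(2,3) by auto
  then have "0 \<le> m" using reps_nonneg by blast
  have "\<exists>h. t \<le> card (reps q A h n)" if "n \<in> {N + m..N + m + int W}" for n
  proof -
    have "n - m \<in> representable" using that by (intro subsetD[OF N(2)]) auto
    then obtain h K where "K \<in> reps q A h (n - m)" unfolding representable_def by blast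
    then have "t \<le> card (reps q A (\<lambda>i. k i + h i) n)"
      using card_reps_shift[of K h "n - m" k m] assms(3) by simp
    then show ?thesis by blast
  qed
  then obtain h where "\<And>h'. tuple_le q h h' \<Longrightarrow> \<forall>n\<in>{N + m..N + m + int W}. t \<le> card (reps q A h' n)"
    using uniform_bound[of "{N + m..N + m + int W}" t] by blast
  moreover have "tuple_le q h h" by (simp add: tuple_le_def)
  ultimately show ?thesis using N(1) \<open>0 \<le> m\<close> by (intro exI[of _ "N + m"]) auto
qed

text \<open>Induction on the total of \<open>k\<close>, with one unit removed from some component
  \<open>i\<close>. The old interval persists by monotonicity, and its translate by
  \<open>a i\<close> covers the new part.\<close>

lemma rep_window_extend:
  assumes window: "\<And>n. n \<in> {c..c + W} \<Longrightarrow> t \<le> card (reps q A h n)"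
    and a: "\<And>i. i \<in> {1..q} \<Longrightarrow> a i \<in> A i \<and> a i \<le> W"
    and n: "n \<in> {c..c + W + tuple_dot q k a}"
  shows "t \<le> card (reps q A (\<lambda>i. h i + k i) n)"
  using n
proof (induction "\<Sum>i=1..q. k i" arbitrary: k n)
  case 0
  then have "reps q A (\<lambda>i. h i + k i) n = reps q A h n" by (intro reps_cong) auto
  with 0 window show ?case by (auto simp: tuple_dot_def)
next
  case (Suc s)
  then obtain i where i: "i \<in> {1..q}" "0 < k i" by (metis Suc_neq_Zero gr0I sum.neutral)
  define k' where "k' = k(i := k i - 1)"
  have k: "k j = k' j + (if j = i then 1 else 0)" for j using i by (simp add: k'_def)
  have "(\<Sum>j=1..q. k j) = (\<Sum>j=1..q. k' j) + 1"
    unfolding k using i(1) by (simp add: sum.distrib)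
  then have s: "s = (\<Sum>j=1..q. k' j)" using Suc.hyps(2) by simp
  have "tuple_dot q k a = tuple_dot q k' a + (\<Sum>j=1..q. if j = i then a j else 0)"
    unfolding tuple_dot_def sum.distrib[symmetric]
    by (intro sum.cong) (auto simp: k algebra_simps)
  then have dot: "tuple_dot q k a = tuple_dot q k' a + a i" using i(1) by simp
  have dot_nonneg: "0 \<le> tuple_dot q k' a"
    unfolding tuple_dot_def using a nonneg_A by (intro sum_nonneg) auto
  have eq: "(\<lambda>j. h j + k j) = (\<lambda>j. (h j + k' j) + (if j = i then 1 else 0))"
    by (simp add: k fun_eq_iff)
  show ?case
  proof (cases "n \<le> c + W + tuple_dot q k' a")
    case True
    then have "t \<le> card (reps q A (\<lambda>j. h j + k' j) n)"
      using Suc.hyps(1)[OF s] Suc.prems by auto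
    also have "\<dots> \<le> card (reps q A (\<lambda>j. h j + k j) n)"
      by (rule card_reps_mono) (simp add: tuple_le_def k)
    finally show ?thesis .
  next
    case False
    \<comment> \<open>The lower bound uses \<open>a i \<le> W\<close>: \<open>n\<close> exceeds
      \<open>c + W\<close>, so subtracting \<open>a i\<close> stays above \<open>c\<close>.\<close>
    then have "n - a i \<in> {c..c + W + tuple_dot q k' a}"
      using Suc.prems dot dot_nonneg a[OF i(1)] by auto
    then have "t \<le> card (reps q A (\<lambda>j. h j + k' j) (n - a i))"
      using Suc.hyps(1)[OF s] by blast
    also have "\<dots> \<le> card (reps q A (\<lambda>j. h j + k j) n)"
      using card_reps_shift[OF singleton_rep[OF i(1)], of "a i" "\<lambda>j. h j + k' j" "n - a i"] a[OF i(1)]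
      unfolding eq by simp
    finally show ?thesis .
  qed
qed

text \<open>Only finitely many \<open>n\<close> lie below \<open>c\<close>, so one vector serves all
  those that ever reach \<open>t\<close> representations.\<close>

lemma stable_reps:
  "\<exists>h. \<forall>h'. tuple_le q h h' \<longrightarrow>
    (\<forall>n\<in>{0..<c}. t \<le> card (reps q A h' n) \<longleftrightarrow> (\<exists>k. t \<le> card (reps q A k n)))"
  using uniform_bound[of "{n \<in> {0..<c}. \<exists>k. t \<le> card (reps q A k n)}" t] by fastforce

end

section \<open>Reflection of the family\<close>

text \<open>Applying \<open>a i - x\<close> to each entry turns the sum of \<open>h i\<close>
  entries into \<open>h i * a i\<close> minus that sum. Finiteness is assumed because
  \<open>card\<close> is 0 on infinite sets.\<close>

lemma card_reps_reflect_le: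
  assumes "\<And>h n. finite (reps q (\<lambda>i. (\<lambda>x. a i - x) ` A i) h n)"
  shows "card (reps q A h n) \<le> card (reps q (\<lambda>i. (\<lambda>x. a i - x) ` A i) h (tuple_dot q h a - n))"
proof (rule card_inj_on_le)
  let ?f = "\<lambda>M. restrict (\<lambda>i. image_mset (\<lambda>x. a i - x) (M i)) {1..q}"
  show "inj_on ?f (reps q A h n)"
  proof (rule inj_onI)
    fix M M' assume M: "M \<in> reps q A h n" "M' \<in> reps q A h n" and eq: "?f M = ?f M'"
    have "M i = M' i" if "i \<in> {1..q}" for i
    proof -
      have "image_mset (\<lambda>x. a i - x) (M i) = image_mset (\<lambda>x. a i - x) (M' i)"
        using fun_cong[OF eq, of i] that by simp
      then have "image_mset (\<lambda>x. a i - x) (image_mset (\<lambda>x. a i - x) (M i))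
               = image_mset (\<lambda>x. a i - x) (image_mset (\<lambda>x. a i - x) (M' i))" by simp
      then show ?thesis by (simp add: multiset.map_comp comp_def)
    qed
    then show "M = M'" using M repsD(4) by (intro extensionalityI[of _ "{1..q}"]) blast+
  qed
  show "?f ` reps q A h n \<subseteq> reps q (\<lambda>i. (\<lambda>x. a i - x) ` A i) h (tuple_dot q h a - n)"
  proof clarify
    fix M assume M: "M \<in> reps q A h n"
    have *: "sum_mset (image_mset (\<lambda>x. b - x) X) = int (size X) * b - sum_mset X" for b X
      by (induction X) (auto simp: algebra_simps)
    have "(\<Sum>i=1..q. sum_mset (image_mset (\<lambda>x. a i - x) (M i))) = tuple_dot q h a - n"
      using repsD(1,3)[OF M] by (simp add: * tuple_dot_def sum_subtractf)
    then show "?f M \<in> reps q (\<lambda>i. (\<lambda>x. a i - x) ` A i) h (tuple_dot q h a - n)"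
      using repsD(1,2)[OF M] by (intro repsI) auto
  qed
qed (rule assms)

text \<open>Reflection is an involution on families and on targets, so the inequality applied to
  both families gives equality.\<close>

lemma card_reps_reflect:
  assumes "finite_family q A" "finite_family q (\<lambda>i. (\<lambda>x. a i - x) ` A i)"
  shows "card (reps q (\<lambda>i. (\<lambda>x. a i - x) ` A i) h (tuple_dot q h a - n)) = card (reps q A h n)"
proof (rule antisym)
  let ?B = "\<lambda>i. (\<lambda>x. a i - x) ` A i"
  have "(\<lambda>i. (\<lambda>x. a i - x) ` ?B i) = A" by (simp add: image_image)
  then show "card (reps q ?B h (tuple_dot q h a - n)) \<le> card (reps q A h n)"
    using card_reps_reflect_le[of q a ?B h "tuple_dot q h a - n"] finite_family.finite_reps[OF assms(1)]
    by simp
  show "card (reps q A h n) \<le> card (reps q ?B h (tuple_dot q h a - n))"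
    by (rule card_reps_reflect_le) (rule finite_family.finite_reps[OF assms(2)])
qed

section \<open>Assembling the interval and the two stable ends\<close>

theorem theorem2:
  fixes q :: nat and A :: "nat \<Rightarrow> int set" and a_max :: "nat \<Rightarrow> int" and t :: nat
  assumes "q \<ge> 1"
    and "normalized_tuple q A"
    and "\<forall>i\<in>{1..q}. a_max i = Max (A i) \<and> a_max i \<ge> 1"
    and "t \<ge> 1"
    and "\<not> (q = 1 \<and> A 1 = {0, 1} \<and> t \<ge> 2)"
  shows "\<exists>(c::int) (d::int) (C::int set) (D::int set) (ht::nat \<Rightarrow> nat).
    0 \<le> c \<and> 0 \<le> d \<and> finite C \<and> C \<subseteq> {0..} \<and> finite D \<and> D \<subseteq> {0..} \<and>
    (\<forall>h. tuple_le q ht h \<longrightarrow>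
      tuple_sumset_rep q h A t =
        C \<union> {c .. tuple_dot q h a_max - d} \<union> (\<lambda>x. tuple_dot q h a_max - x) ` D)"
proof -
  let ?B = "\<lambda>i. (\<lambda>x. a_max i - x) ` A i"
  have A: "finite (A i)" "A i \<noteq> {}" "Min (A i) = 0" if "i \<in> {1..q}" for i
    using assms(2) that by (auto simp: normalized_tuple_def)
  have gcd: "Gcd (\<Union>i\<in>{1..q}. A i) = 1" using assms(2) by (simp add: normalized_tuple_def)
  have zero: "0 \<in> A i" if "i \<in> {1..q}" for i using Min_in[OF A(1,2)[OF that]] A(3)[OF that] by simp
  have amax: "a_max i \<in> A i" "1 \<le> a_max i" if "i \<in> {1..q}" for i
    using bspec[OF assms(3) that] Max_in[OF A(1,2)[OF that]] by simp_all
  have le_amax: "x \<le> a_max i" if "i \<in> {1..q}" "x \<in> A i" for i x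
    using bspec[OF assms(3) that(1)] Max_ge[OF A(1)[OF that(1)] that(2)] by simp
  have nonneg: "0 \<le> x" if "i \<in> {1..q}" "x \<in> A i" for i x
    using Min_le[OF A(1)[OF that(1)] that(2)] A(3)[OF that(1)] by simp
  interpret A: finite_family q A
    by unfold_locales (use A zero nonneg in auto)
  interpret B: finite_family q ?B
    by unfold_locales (use A amax le_amax in \<open>force+\<close>)
  note reflect = card_reps_reflect[OF A.finite_family_axioms B.finite_family_axioms]

  have "\<exists>k m. t \<le> card (reps q A k m)"
  proof (cases "t = 1")
    case True
    have "0 < card (reps q A (\<lambda>_. 0) 0)"
      using A.zero_rep[of "\<lambda>_. 0"] A.finite_reps card_gt_0_iff by blast
    then show ?thesis using True by (metis One_nat_def Suc_leI)
  next
    case False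
    \<comment> \<open>Coins are pairs \<open>(i, a)\<close>: equal values in different components
      count as distinct, so two maxima suffice when \<open>q \<ge> 2\<close>.\<close>
    have "\<exists>i\<in>{1..q}. \<exists>j\<in>{1..q}. \<exists>a\<in>A i. \<exists>b\<in>A j. 0 < a \<and> 0 < b \<and> (i, a) \<noteq> (j, b)"
    proof (cases "q = 1")
      case True
      have "\<not> A 1 \<subseteq> {0, a_max 1}"
      proof
        assume "A 1 \<subseteq> {0, a_max 1}"
        then have "A 1 = {0, a_max 1}" using zero[of 1] amax[of 1] True by auto
        \<comment> \<open>The gcd of \<open>{0, a_max 1}\<close> is \<open>a_max 1\<close>, hence 1:
          the excluded case.\<close>
        then have "A 1 = {0, 1}" using gcd True amax(2)[of 1] by simp
        then show False using assms(4,5) True False by simp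
      qed
      then obtain b where "b \<in> A 1" "b \<noteq> 0" "b \<noteq> a_max 1" by blast
      then show ?thesis
        using True amax[of 1] nonneg[of 1 b]
        by (intro bexI[of _ 1] bexI[of _ "a_max 1"] bexI[of _ b]) auto
    next
      case False
      then have "1 \<in> {1..q}" "2 \<in> {1..q}" using assms(1) by auto
      then show ?thesis using amax[of 1] amax[of 2]
        by (intro bexI[of _ 1] bexI[of _ 2] bexI[of _ "a_max 1"] bexI[of _ "a_max 2"]) auto
    qed
    then show ?thesis using A.reps_of_two_coins by blast
  qed
  then obtain k m where km: "t \<le> card (reps q A k m)" by blast

  define W where "W = nat (\<Sum>i=1..q. a_max i)"
  have le_W: "a_max i \<le> int W" if "i \<in> {1..q}" for i
  proof -
    have "0 \<le> a_max j" if "j \<in> {1..q}" for j using amax(2)[OF that] by simp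
    then have "a_max i \<le> (\<Sum>i=1..q. a_max i)" using that by (intro member_le_sum) auto
    then show ?thesis by (simp add: W_def)
  qed
  obtain c h0 where "0 \<le> c" and window: "\<And>n. n \<in> {c..c + int W} \<Longrightarrow> t \<le> card (reps q A h0 n)"
    using A.rep_window[OF gcd assms(4) km, of W] by blast
  \<comment> \<open>For \<open>h = h0 + k\<close> the interval grows up to
    \<open>c + W + tuple_dot q k a_max\<close>, which is \<open>tuple_dot q h a_max\<close> minus
    the second argument of \<open>max\<close>; the 0 keeps \<open>d\<close> nonnegative.\<close>
  define d where "d = max 0 (tuple_dot q h0 a_max - (c + int W))"
  have middle: "t \<le> card (reps q A h n)" if h: "tuple_le q h0 h" and n: "n \<in> {c..tuple_dot q h a_max - d}" for h n
  proof -
    define k where "k i = h i - h0 i" for i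
    have hk: "h0 i + k i = h i" if "i \<in> {1..q}" for i using h that by (simp add: k_def tuple_le_def)
    have "tuple_dot q h a_max = (\<Sum>i=1..q. int (h0 i + k i) * a_max i)"
      unfolding tuple_dot_def by (intro sum.cong) (simp_all add: hk)
    also have "\<dots> = tuple_dot q h0 a_max + tuple_dot q k a_max"
      by (simp add: tuple_dot_def sum.distrib algebra_simps)
    finally have "n \<in> {c..c + int W + tuple_dot q k a_max}" using n by (auto simp: d_def)
    then have "t \<le> card (reps q A (\<lambda>i. h0 i + k i) n)"
      using window amax(1) le_W by (intro A.rep_window_extend[where c = c and W = "int W" and a = a_max]) auto
    also have "reps q A (\<lambda>i. h0 i + k i) n = reps q A h n" by (rule reps_cong) (rule hk)
    finally show ?thesis .
  qed

  \<comment> \<open>\<open>C\<close> and \<open>D\<close> are the stable values at the two ends,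
    \<open>D\<close> being measured downwards from \<open>tuple_dot q h a_max\<close> through the
    reflected family.\<close>
  define C where "C = {n \<in> {0..<c}. \<exists>k. t \<le> card (reps q A k n)}"
  define D where "D = {n \<in> {0..<d}. \<exists>k. t \<le> card (reps q ?B k n)}"
  obtain h1 where h1: "\<And>h n. tuple_le q h1 h \<Longrightarrow> n \<in> {0..<c} \<Longrightarrow>
      t \<le> card (reps q A h n) \<longleftrightarrow> (\<exists>k. t \<le> card (reps q A k n))"
    using A.stable_reps[of c t] by blast
  obtain h2 where h2: "\<And>h n. tuple_le q h2 h \<Longrightarrow> n \<in> {0..<d} \<Longrightarrow>
      t \<le> card (reps q ?B h n) \<longleftrightarrow> (\<exists>k. t \<le> card (reps q ?B k n))"
    using B.stable_reps[of d t] by blast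
  define ht where "ht i = h0 i + h1 i + h2 i" for i

  have main: "tuple_sumset_rep q h A t =
      C \<union> {c..tuple_dot q h a_max - d} \<union> (\<lambda>x. tuple_dot q h a_max - x) ` D" if "tuple_le q ht h" for h
  proof -
    let ?T = "tuple_dot q h a_max"
    have le: "tuple_le q h0 h" "tuple_le q h1 h" "tuple_le q h2 h"
      using that unfolding tuple_le_def ht_def by fastforce+
    have C: "n \<in> C \<longleftrightarrow> n \<in> {0..<c} \<and> t \<le> card (reps q A h n)" for n
      using h1[OF le(2)] unfolding C_def by blast
    have D: "?T - n \<in> D \<longleftrightarrow> ?T - n \<in> {0..<d} \<and> t \<le> card (reps q A h n)" for n
      using h2[OF le(3), of "?T - n"] reflect[of h n] unfolding D_def by auto
    \<comment> \<open>The upper bound is nonnegativity of \<open>?T - n\<close>, which the reflected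
      family represents.\<close>
    have range: "0 \<le> n \<and> n \<le> ?T" if "t \<le> card (reps q A h n)" for n
    proof -
      have "reps q A h n \<noteq> {}" "reps q ?B h (?T - n) \<noteq> {}"
        using that assms(4) reflect[of h n] by (metis card.empty not_one_le_zero order_trans)+
      then show ?thesis using A.reps_nonneg B.reps_nonneg by fastforce
    qed
    have img: "n \<in> (\<lambda>x. ?T - x) ` D \<longleftrightarrow> ?T - n \<in> D" for n
      by (metis (no_types, lifting) diff_diff_eq2 add_diff_cancel_left' imageE image_eqI)
    show ?thesis
      unfolding tuple_sumset_rep_eq[OF assms(4)] set_eq_iff Un_iff C img D
      \<comment> \<open>An \<open>n\<close> with \<open>t\<close> representations has
        \<open>n < c\<close>, or \<open>?T - n < d\<close>, or lies in the interval;
        \<open>middle\<close> gives the converse for the interval.\<close>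
      using range middle[OF le(1)] by fastforce
  qed
  have "C \<subseteq> {0..<c}" "D \<subseteq> {0..<d}" by (auto simp: C_def D_def)
  then have "finite C" "C \<subseteq> {0..}" "finite D" "D \<subseteq> {0..}"
    by (auto intro: finite_subset[OF _ finite_atLeastLessThan_int])
  moreover have "0 \<le> d" by (simp add: d_def)
  ultimately show ?thesis using main \<open>0 \<le> c\<close> by blast
qed

end
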